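(* Let $P$ be a Poisson manifold with Poisson tensor $\Pi$ and bracket $\{\cdot,\cdot\}$, let $H_0$ be a smooth function on $P$ with values in complex $N\times N$ matrices, and let $\lambda$ be a regular eigenvalue function for $H_0$ which is non-degenerate (i.e. of multiplicity $1$), with associated projection $\pi_0$ onto the eigenbundle $E_\lambda$. Let $$\tilde D\xi=\pi_0\,d(\pi_0\xi)+(I-\pi_0)\,d\bigl((I-\pi_0)\xi\bigr)$$ be the adapted connection on the trivial bundle $P\times\mathbb C^N$. Then the curvature of $\tilde D$ is $\tilde F=d\pi_0\wedge d\pi_0$, and $$\pi_0\{\pi_0,H_0-\lambda I\}\pi_0=\Lambda_C^{(s)}\,\pi_0,\qquad\text{where}\quad \Lambda_C^{(s)}=\bigl\langle\Pi,\operatorname{tr}(H_0\tilde F)\bigr\rangle .$$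
   Context: A smooth scalar function $\lambda$ on $P$ is a regular eigenvalue function for $H_0$ if $\lambda(x)$ is an eigenvalue of $H_0(x)$ with multiplicity independent of $x$, and for every $x$ the null space and range of $H_0(x)-\lambda(x)I$ are complementary subspaces of $\mathbb C^N$. $\pi_0(x)$ denotes the projection onto the null space of $H_0(x)-\lambda(x)I$ along its range (it is smooth in $x$); $E_\lambda$ is the vector bundle over $P$ of images of the $\pi_0(x)$. On the trivial bundle $P\times\mathbb C^N$, $d$ denotes the trivial connection, and $\xi$ an arbitrary section. The Poisson bracket of matrix-valued functions is $\{a,b\}_{ij}=\sum_k\{a_{ik},b_{kj}\}$. Wedge products of matrix-valued forms combine the wedge product of forms with matrix multiplication. $\langle\Pi,\cdot\rangle$ denotes contraction of $2$-forms with the Poisson tensor, normalized so that $\langle\Pi,da\wedge db\rangle=\{a,b\}$. The curvature of $\tilde D$ is the matrix-valued $2$-form $\tilde F$ with $\tilde D^2\xi=\tilde F\xi$, where $\tilde D$ is extended to a covariant exterior derivative. *)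

theory Defs
  imports "HOL-Analysis.Analysis"
begin

section \<open>Smooth manifolds\<close>

text \<open>For open \<open>S\<close> in a finite-dimensional normed space this is the usual notion of a
  \<open>C\<^sup>k\<close> map: existence and continuity of all iterated directional derivatives.\<close>

primrec Ck_on :: "nat \<Rightarrow> 'e::real_normed_vector set \<Rightarrow> ('e \<Rightarrow> 'b::real_normed_vector) \<Rightarrow> bool" where
  "Ck_on 0 S f = continuous_on S f"
| "Ck_on (Suc k) S f =
     (f differentiable_on S \<and> (\<forall>v. Ck_on k S (\<lambda>x. frechet_derivative f (at x) v)))"

definition smooth_on :: "'e::real_normed_vector set \<Rightarrow> ('e \<Rightarrow> 'b::real_normed_vector) \<Rightarrow> bool" where
  "smooth_on S f \<longleftrightarrow> (\<forall>k. Ck_on k S f)"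

type_synonym ('a, 'e) chart = "'a set \<times> ('a \<Rightarrow> 'e)"

text \<open>The underlying set is the whole type \<open>'a\<close>. The model space is a finite-dimensional real
  normed space rather than a Euclidean space, because the class \<open>euclidean_space\<close> excludes
  dimension 0.\<close>

locale smooth_manifold =
  fixes atlas :: "('a::{t2_space, second_countable_topology}, 'e::real_normed_vector) chart set"
  assumes finite_dim: "\<exists>B :: 'e set. finite B \<and> span B = UNIV"
    and covering: "(\<Union>(U, \<phi>)\<in>atlas. U) = UNIV"
    and chart: "(U, \<phi>) \<in> atlas \<Longrightarrow>
      open U \<and> open (\<phi> ` U) \<and> homeomorphism U (\<phi> ` U) \<phi> (inv_into U \<phi>)"
    and compatible: "(U, \<phi>) \<in> atlas \<Longrightarrow> (V, \<psi>) \<in> atlas \<Longrightarrow>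
      smooth_on (\<phi> ` (U \<inter> V)) (\<psi> \<circ> inv_into U \<phi>)"

definition smooth_maps :: "('a, 'e::real_normed_vector) chart set \<Rightarrow> ('a \<Rightarrow> 'b::real_normed_vector) set"
  where "smooth_maps atlas = {f. \<forall>(U, \<phi>)\<in>atlas. smooth_on (\<phi> ` U) (f \<circ> inv_into U \<phi>)}"


section \<open>Vector fields and differential forms\<close>

text \<open>Smooth vector fields are the derivations of the algebra of real smooth functions. The last
  clause only fixes the value outside this algebra, so that equal derivations are equal as
  functions.\<close>

type_synonym 'a vfield = "('a \<Rightarrow> real) \<Rightarrow> 'a \<Rightarrow> real"

definition vector_fields :: "('a, 'e::real_normed_vector) chart set \<Rightarrow> 'a vfield set" where
  "vector_fields atlas = {X.
     (\<forall>f\<in>smooth_maps atlas. X f \<in> smooth_maps atlas) \<and>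
     (\<forall>f\<in>smooth_maps atlas. \<forall>g\<in>smooth_maps atlas. X (\<lambda>x. f x + g x) = (\<lambda>x. X f x + X g x)) \<and>
     (\<forall>c. \<forall>f\<in>smooth_maps atlas. X (\<lambda>x. c * f x) = (\<lambda>x. c * X f x)) \<and>
     (\<forall>f\<in>smooth_maps atlas. \<forall>g\<in>smooth_maps atlas.
        X (\<lambda>x. f x * g x) = (\<lambda>x. f x * X g x + X f x * g x)) \<and>
     (\<forall>f. f \<notin> smooth_maps atlas \<longrightarrow> X f = (\<lambda>x. 0))}"

definition vf_add :: "'a vfield \<Rightarrow> 'a vfield \<Rightarrow> 'a vfield" where
  "vf_add X Y = (\<lambda>f x. X f x + Y f x)"

definition vf_scale :: "('a \<Rightarrow> real) \<Rightarrow> 'a vfield \<Rightarrow> 'a vfield" where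
  "vf_scale g X = (\<lambda>f x. g x * X f x)"

definition lie_bracket :: "'a vfield \<Rightarrow> 'a vfield \<Rightarrow> 'a vfield" where
  "lie_bracket X Y = (\<lambda>f x. X (Y f) x - Y (X f) x)"

text \<open>A \<open>'b\<close>-valued \<open>k\<close>-form is an alternating map on \<open>k\<close> vector fields that is multilinear over
  the smooth functions. The target \<open>'b\<close> is \<^typ>\<open>complex\<close>, \<open>\<complex>\<^sup>N\<close> or the complex matrices.\<close>

type_synonym ('a, 'b) form1 = "'a vfield \<Rightarrow> 'a \<Rightarrow> 'b"
type_synonym ('a, 'b) form2 = "'a vfield \<Rightarrow> 'a vfield \<Rightarrow> 'a \<Rightarrow> 'b"

definition two_forms ::
  "('a, 'e::real_normed_vector) chart set \<Rightarrow> ('a, 'b::euclidean_space) form2 set" where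
  "two_forms atlas = {\<omega>.
     (\<forall>X\<in>vector_fields atlas. \<forall>Y\<in>vector_fields atlas. \<omega> X Y \<in> smooth_maps atlas) \<and>
     (\<forall>X\<in>vector_fields atlas. \<omega> X X = (\<lambda>x. 0)) \<and>
     (\<forall>X\<in>vector_fields atlas. \<forall>Y\<in>vector_fields atlas. \<forall>Z\<in>vector_fields atlas.
        \<omega> (vf_add X Y) Z = (\<lambda>x. \<omega> X Z x + \<omega> Y Z x) \<and>
        \<omega> Z (vf_add X Y) = (\<lambda>x. \<omega> Z X x + \<omega> Z Y x)) \<and>
     (\<forall>g\<in>smooth_maps atlas. \<forall>X\<in>vector_fields atlas. \<forall>Y\<in>vector_fields atlas.
        \<omega> (vf_scale g X) Y = (\<lambda>x. g x *\<^sub>R \<omega> X Y x) \<and>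
        \<omega> X (vf_scale g Y) = (\<lambda>x. g x *\<^sub>R \<omega> X Y x))}"

text \<open>The differential \<open>(df)(X) = X f\<close>, taken componentwise in the real coordinates of \<open>'b\<close>.\<close>

definition diff :: "('a \<Rightarrow> 'b::euclidean_space) \<Rightarrow> ('a, 'b) form1" where
  "diff f = (\<lambda>X x. \<Sum>b\<in>Basis. X (\<lambda>y. f y \<bullet> b) x *\<^sub>R b)"

text \<open>The argument \<open>m\<close> is the product of the values: \<open>(*)\<close> for scalar forms, \<open>(**)\<close> for
  matrix-valued forms.\<close>

definition wedge ::
  "('b \<Rightarrow> 'c \<Rightarrow> 'd::ab_group_add) \<Rightarrow> ('a, 'b) form1 \<Rightarrow> ('a, 'c) form1 \<Rightarrow> ('a, 'd) form2" where
  "wedge m \<alpha> \<beta> = (\<lambda>X Y x. m (\<alpha> X x) (\<beta> Y x) - m (\<alpha> Y x) (\<beta> X x))"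


section \<open>Poisson manifolds\<close>

text \<open>A bivector field is given by its contraction with complex-valued 2-forms. Smooth bivector
  fields form the exterior square, over the smooth functions, of the module of vector fields: since
  this module is finitely generated and projective, every smooth bivector field is a finite sum of
  fields \<open>X \<and> Y\<close>, and \<open>X \<and> Y\<close> contracts with \<open>\<omega>\<close> to \<open>\<omega> X Y\<close>.\<close>

type_synonym 'a bivector = "('a, complex) form2 \<Rightarrow> 'a \<Rightarrow> complex"

definition bivector_field :: "('a, 'e::real_normed_vector) chart set \<Rightarrow> 'a bivector \<Rightarrow> bool" where
  "bivector_field atlas PiT \<longleftrightarrow>
     (\<exists>l. set l \<subseteq> vector_fields atlas \<times> vector_fields atlas \<and>
       (\<forall>\<omega>\<in>two_forms atlas. PiT \<omega> = (\<lambda>x. \<Sum>(X, Y)\<leftarrow>l. \<omega> X Y x)))"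

definition pbracket :: "'a bivector \<Rightarrow> ('a \<Rightarrow> complex) \<Rightarrow> ('a \<Rightarrow> complex) \<Rightarrow> 'a \<Rightarrow> complex" where
  "pbracket PiT a b = PiT (wedge (*) (diff a) (diff b))"

text \<open>The bracket of real functions is real; stating the Jacobi identity for complex-valued
  functions is the same by complex bilinearity.\<close>

locale poisson_manifold = smooth_manifold atlas
  for atlas :: "('a::{t2_space, second_countable_topology}, 'e::real_normed_vector) chart set" +
  fixes PiT :: "'a bivector"
  assumes bivector: "bivector_field atlas PiT"
    and jacobi: "a \<in> smooth_maps atlas \<Longrightarrow> b \<in> smooth_maps atlas \<Longrightarrow> c \<in> smooth_maps atlas \<Longrightarrow>
      pbracket PiT a (pbracket PiT b c) x + pbracket PiT b (pbracket PiT c a) x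
        + pbracket PiT c (pbracket PiT a b) x = 0"

definition matrix_pbracket ::
  "'a bivector \<Rightarrow> ('a \<Rightarrow> complex^'n^'n) \<Rightarrow> ('a \<Rightarrow> complex^'n^'n) \<Rightarrow> 'a \<Rightarrow> complex^'n^'n" where
  "matrix_pbracket PiT A B x =
     (\<chi> i j. \<Sum>k\<in>UNIV. pbracket PiT (\<lambda>y. A y $ i $ k) (\<lambda>y. B y $ k $ j) x)"


section \<open>Regular eigenvalue functions\<close>

definition null_space :: "complex^'n^'n \<Rightarrow> (complex^'n) set" where
  "null_space A = {v. A *v v = 0}"

definition complementary :: "(complex^'n) set \<Rightarrow> (complex^'n) set \<Rightarrow> bool" where
  "complementary U W \<longleftrightarrow> U \<inter> W = {0} \<and> (\<forall>v. \<exists>u\<in>U. \<exists>w\<in>W. v = u + w)"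

text \<open>Complementarity of null space and range makes geometric and algebraic multiplicity agree, so
  the multiplicity is taken to be the dimension of the null space.\<close>

definition eigen_multiplicity :: "complex^'n^'n \<Rightarrow> complex \<Rightarrow> nat" where
  "eigen_multiplicity A \<mu> = vec.dim (null_space (A - mat \<mu>))"

definition regular_eigenvalue_function ::
  "('a, 'e::real_normed_vector) chart set \<Rightarrow> ('a \<Rightarrow> complex^'n^'n) \<Rightarrow> ('a \<Rightarrow> complex) \<Rightarrow> bool" where
  "regular_eigenvalue_function atlas H \<mu> \<longleftrightarrow>
     \<mu> \<in> smooth_maps atlas \<and>
     (\<forall>x. \<exists>v. v \<noteq> 0 \<and> H x *v v = \<mu> x *s v) \<and>
     (\<exists>m. \<forall>x. eigen_multiplicity (H x) (\<mu> x) = m) \<and>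
     (\<forall>x. complementary (null_space (H x - mat (\<mu> x))) (range ((*v) (H x - mat (\<mu> x)))))"

definition projection_along :: "complex^'n^'n \<Rightarrow> (complex^'n) set \<Rightarrow> (complex^'n) set \<Rightarrow> bool" where
  "projection_along p U W \<longleftrightarrow> (\<forall>u\<in>U. p *v u = u) \<and> (\<forall>w\<in>W. p *v w = 0)"


section \<open>Connections on the trivial bundle and their curvature\<close>

definition adapted_connection ::
  "('a \<Rightarrow> complex^'n^'n) \<Rightarrow> ('a \<Rightarrow> complex^'n) \<Rightarrow> ('a, complex^'n) form1" where
  "adapted_connection p \<xi> = (\<lambda>X x.
     p x *v diff (\<lambda>y. p y *v \<xi> y) X x
     + (mat 1 - p x) *v diff (\<lambda>y. (mat 1 - p y) *v \<xi> y) X x)"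

text \<open>The extension of a connection \<open>D\<close> to vector-valued 1-forms:
  \<open>(D \<alpha>)(X, Y) = D\<^sub>X (\<alpha> Y) - D\<^sub>Y (\<alpha> X) - \<alpha> [X, Y]\<close>.\<close>

definition covariant_ext_deriv ::
  "(('a \<Rightarrow> complex^'n) \<Rightarrow> ('a, complex^'n) form1) \<Rightarrow>
   ('a, complex^'n) form1 \<Rightarrow> ('a, complex^'n) form2" where
  "covariant_ext_deriv D \<alpha> = (\<lambda>X Y x. D (\<alpha> Y) X x - D (\<alpha> X) Y x - \<alpha> (lie_bracket X Y) x)"

definition is_curvature ::
  "('a, 'e::real_normed_vector) chart set \<Rightarrow> (('a \<Rightarrow> complex^'n) \<Rightarrow> ('a, complex^'n) form1) \<Rightarrow>
   ('a, complex^'n^'n) form2 \<Rightarrow> bool" where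
  "is_curvature atlas D F \<longleftrightarrow> F \<in> two_forms atlas \<and>
     (\<forall>\<xi>\<in>smooth_maps atlas. \<forall>X\<in>vector_fields atlas. \<forall>Y\<in>vector_fields atlas. \<forall>x.
        covariant_ext_deriv D (D \<xi>) X Y x = F X Y x *v \<xi> x)"

definition Lambda_C ::
  "'a bivector \<Rightarrow> ('a \<Rightarrow> complex^'n^'n) \<Rightarrow> ('a, complex^'n^'n) form2 \<Rightarrow> 'a \<Rightarrow> complex" where
  "Lambda_C PiT H F = PiT (\<lambda>X Y x. trace (H x ** F X Y x))"

end

theory Submission
  imports Defs
begin

text \<open>Write \<open>X p\<close> for the derivative of \<open>p = \<pi>0\<close> along \<open>X\<close>. From \<open>p\<^sup>2 = p\<close> one gets
  \<open>p (X p) + (X p) p = X p\<close>, so the adapted connection is \<open>d + [p, dp]\<close> and its curvature on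
  \<open>(X, Y)\<close> is \<open>2 [X p, Y p] - [X p, Y p] = [X p, Y p]\<close>. For \<open>A = H0 - \<mu>\<close>, differentiating
  \<open>A p = 0\<close> moves the derivatives in \<open>p {p, A} p\<close> from \<open>A\<close> to \<open>p\<close>; since \<open>p\<close> has rank one,
  \<open>p C p = tr (C p) p\<close>, and what results is the trace in \<open>\<Lambda>\<^sub>C\<close>, where \<open>\<mu>\<close> drops out because
  commutators are traceless. Smoothness of \<open>p\<close> follows from \<open>p = adj A / tr (adj A)\<close>.\<close>

section \<open>C^k calculus on open subsets of a normed space\<close>

section \<open>Smooth maps\<close>

text \<open>\<open>frechet_derivative\<close> at a point sees a whole neighbourhood, so openness of
  \<open>S\<close> is what lets functions that agree only on \<open>S\<close> have equal derivatives
  at its points.\<close>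

lemma Ck_on_cong:
  assumes "open S" "\<And>x. x \<in> S \<Longrightarrow> f x = g x" "Ck_on k S f"
  shows "Ck_on k S g"
  using assms(2,3)
proof (induction k arbitrary: f g)
  case 0
  then show ?case by (simp cong: continuous_on_cong)
next
  case (Suc k)
  have f: "f differentiable at x" if "x \<in> S" for x
    using Suc.prems(2) that \<open>open S\<close> by (simp add: differentiable_on_eq_differentiable_at)
  have "g differentiable_on S"
    using Suc.prems differentiable_on_eq_differentiable_at[OF \<open>open S\<close>]
    by (auto simp: differentiable_on_def intro: differentiable_transform_within[OF _ zero_less_one])
  moreover have "frechet_derivative f (at x) v = frechet_derivative g (at x) v" if "x \<in> S" for x v
    using frechet_derivative_transform_within_open[OF f[OF that] \<open>open S\<close> that] Suc.prems(1) by simp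
  ultimately show ?case
    using Suc.IH[of "\<lambda>x. frechet_derivative f (at x) v" "\<lambda>x. frechet_derivative g (at x) v" for v]
      Suc.prems(2) by simp
qed

text \<open>Trades the chosen \<open>frechet_derivative\<close> for any explicit derivative formula
  \<open>f'\<close>; the closure inductions below run through this rule.\<close>

lemma Ck_on_SucI:
  assumes "open S" "\<And>x. x \<in> S \<Longrightarrow> (f has_derivative f' x) (at x)" "\<And>v. Ck_on k S (\<lambda>x. f' x v)"
  shows "Ck_on (Suc k) S f"
proof -
  have "f differentiable_on S"
    using assms(1,2) by (auto simp: differentiable_on_eq_differentiable_at differentiable_def)
  moreover have "Ck_on k S (\<lambda>x. frechet_derivative f (at x) v)" for v
    using assms(2) by (intro Ck_on_cong[OF assms(1) _ assms(3)[of v]]) (metis frechet_derivative_at)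
  ultimately show ?thesis by simp
qed

lemma Ck_on_Suc_has_derivative:
  assumes "open S" "Ck_on (Suc k) S f" "x \<in> S"
  shows "(f has_derivative frechet_derivative f (at x)) (at x)"
  using assms by (simp add: differentiable_on_eq_differentiable_at frechet_derivative_works)

lemma Ck_on_Suc_imp_Ck_on: "Ck_on (Suc k) S f \<Longrightarrow> Ck_on k S f"
proof (induction k arbitrary: f)
  case 0
  then show ?case by (simp add: differentiable_imp_continuous_on)
next
  case (Suc k)
  then have "Ck_on k S (\<lambda>x. frechet_derivative f (at x) v)" for v
    by simp
  with Suc.prems show ?case by simp
qed

lemma Ck_on_const:
  assumes "open S" shows "Ck_on k S (\<lambda>x. c)"
proof (induction k arbitrary: c)
  case (Suc k)
  then show ?case by (intro Ck_on_SucI[OF assms, where f' = "\<lambda>_ _. 0"]) auto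
qed simp

lemma Ck_on_bounded_linear:
  assumes "open S" "bounded_linear L" "Ck_on k S f"
  shows "Ck_on k S (\<lambda>x. L (f x))"
  using assms(3)
proof (induction k arbitrary: f)
  case 0
  then show ?case using assms(2) by (simp add: bounded_linear.continuous_on)
next
  case (Suc k)
  note f = Ck_on_Suc_has_derivative[OF assms(1) Suc.prems]
  show ?case
    by (rule Ck_on_SucI[OF assms(1) bounded_linear.has_derivative[OF assms(2) f]])
      (use Suc in auto)
qed

lemma Ck_on_add:
  assumes "open S" "Ck_on k S f" "Ck_on k S g"
  shows "Ck_on k S (\<lambda>x. f x + g x)"
  using assms(2,3)
proof (induction k arbitrary: f g)
  case 0
  then show ?case by (simp add: continuous_on_add)
next
  case (Suc k)
  note fg = Suc.prems[THEN Ck_on_Suc_has_derivative[OF assms(1)]]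
  show ?case
    by (rule Ck_on_SucI[OF assms(1) has_derivative_add[OF fg]]) (use Suc in auto)
qed

text \<open>Handles scalar, matrix and matrix-vector products at once. The Leibniz formula involves
  \<open>f\<close> and \<open>g\<close> undifferentiated, so the induction also uses that C^(k+1)
  implies C^k.\<close>

lemma Ck_on_bounded_bilinear:
  assumes "open S" "bounded_bilinear m" "Ck_on k S f" "Ck_on k S g"
  shows "Ck_on k S (\<lambda>x. m (f x) (g x))"
  using assms(3,4)
proof (induction k arbitrary: f g)
  case 0
  then show ?case using assms(2) by (simp add: bounded_bilinear.continuous_on)
next
  case (Suc k)
  note fg = Suc.prems[THEN Ck_on_Suc_has_derivative[OF assms(1)]]
  have "Ck_on k S f" "Ck_on k S g"
    using Suc.prems by (auto intro: Ck_on_Suc_imp_Ck_on simp del: Ck_on.simps)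
  then show ?case
    by (intro Ck_on_SucI[OF assms(1) bounded_bilinear.FDERIV[OF assms(2) fg]] Ck_on_add[OF assms(1)] Suc.IH)
      (use Suc.prems in auto)
qed

text \<open>The derivative of 1/f is -(1/f) f' (1/f), built from f' and from 1/f at order k, which
  the induction hypothesis supplies.\<close>

lemma Ck_on_inverse:
  fixes f :: "'e::real_normed_vector \<Rightarrow> 'b::real_normed_field"
  assumes "open S" "\<And>x. x \<in> S \<Longrightarrow> f x \<noteq> 0" "Ck_on k S f"
  shows "Ck_on k S (\<lambda>x. inverse (f x))"
  using assms(3)
proof (induction k)
  case 0
  then show ?case using assms(2) by (simp add: continuous_on_inverse)
next
  case (Suc k)
  have inv: "Ck_on k S (\<lambda>x. inverse (f x))"
    using Suc by (auto intro: Ck_on_Suc_imp_Ck_on simp del: Ck_on.simps)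
  have "Ck_on k S (\<lambda>x. - (inverse (f x) * frechet_derivative f (at x) v * inverse (f x)))" for v
    by (intro Ck_on_bounded_linear[OF assms(1) bounded_linear_minus[OF bounded_linear_ident]]
        Ck_on_bounded_bilinear[OF assms(1) bounded_bilinear_mult] inv)
      (use Suc.prems in auto)
  moreover note Deriv.has_derivative_inverse[OF assms(2) Ck_on_Suc_has_derivative[OF assms(1) Suc.prems]]
  ultimately show ?case
    by (intro Ck_on_SucI[OF assms(1), where f' =
          "\<lambda>x v. - (inverse (f x) * frechet_derivative f (at x) v * inverse (f x))"])
qed

section \<open>Closure properties of smooth maps on the manifold\<close>

context smooth_manifold
begin

lemma smooth_mapsI:
  assumes "\<And>U \<phi> k. (U, \<phi>) \<in> atlas \<Longrightarrow> open (\<phi> ` U) \<Longrightarrow> Ck_on k (\<phi> ` U) (\<lambda>y. f (inv_into U \<phi> y))"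
  shows "f \<in> smooth_maps atlas"
proof -
  have "Ck_on k (\<phi> ` U) (f \<circ> inv_into U \<phi>)" if "(U, \<phi>) \<in> atlas" for U \<phi> k
    using assms[OF that] chart[OF that] by (simp add: o_def)
  then show ?thesis by (auto simp: smooth_maps_def smooth_on_def)
qed

lemma smooth_mapsD:
  "f \<in> smooth_maps atlas \<Longrightarrow> (U, \<phi>) \<in> atlas \<Longrightarrow> Ck_on k (\<phi> ` U) (\<lambda>y. f (inv_into U \<phi> y))"
  by (auto simp: smooth_maps_def smooth_on_def o_def)

lemma smooth_maps_const: "(\<lambda>x. c) \<in> smooth_maps atlas"
  by (intro smooth_mapsI Ck_on_const)

lemma smooth_maps_add:
  "f \<in> smooth_maps atlas \<Longrightarrow> g \<in> smooth_maps atlas \<Longrightarrow> (\<lambda>x. f x + g x) \<in> smooth_maps atlas"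
  by (intro smooth_mapsI Ck_on_add) (simp_all add: smooth_mapsD[of f] smooth_mapsD[of g])

lemma smooth_maps_bounded_linear:
  "bounded_linear L \<Longrightarrow> f \<in> smooth_maps atlas \<Longrightarrow> (\<lambda>x. L (f x)) \<in> smooth_maps atlas"
  by (intro smooth_mapsI Ck_on_bounded_linear[where L = L]) (simp_all add: smooth_mapsD[of f])

lemma smooth_maps_bounded_bilinear:
  "bounded_bilinear m \<Longrightarrow> f \<in> smooth_maps atlas \<Longrightarrow> g \<in> smooth_maps atlas \<Longrightarrow>
    (\<lambda>x. m (f x) (g x)) \<in> smooth_maps atlas"
  by (intro smooth_mapsI Ck_on_bounded_bilinear[where m = m]) (simp_all add: smooth_mapsD[of f] smooth_mapsD[of g])

lemma smooth_maps_inverse: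
  fixes f :: "'a \<Rightarrow> 'b::real_normed_field"
  assumes "f \<in> smooth_maps atlas" "\<And>x. f x \<noteq> 0"
  shows "(\<lambda>x. inverse (f x)) \<in> smooth_maps atlas"
  using assms by (intro smooth_mapsI Ck_on_inverse) (auto simp: smooth_mapsD[of f])

lemma smooth_maps_diff:
  assumes "f \<in> smooth_maps atlas" "g \<in> smooth_maps atlas"
  shows "(\<lambda>x. f x - g x) \<in> smooth_maps atlas"
  using smooth_maps_add[OF assms(1)
      smooth_maps_bounded_linear[OF bounded_linear_minus[OF bounded_linear_ident] assms(2)]]
  by simp

lemma smooth_maps_sum:
  "finite I \<Longrightarrow> (\<And>i. i \<in> I \<Longrightarrow> f i \<in> smooth_maps atlas) \<Longrightarrow> (\<lambda>x. \<Sum>i\<in>I. f i x) \<in> smooth_maps atlas"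
  by (induction I rule: finite_induct) (simp_all add: smooth_maps_const smooth_maps_add)

lemma smooth_maps_prod:
  fixes f :: "'i \<Rightarrow> 'a \<Rightarrow> 'b::real_normed_field"
  shows "finite I \<Longrightarrow> (\<And>i. i \<in> I \<Longrightarrow> f i \<in> smooth_maps atlas) \<Longrightarrow>
    (\<lambda>x. \<Prod>i\<in>I. f i x) \<in> smooth_maps atlas"
  by (induction I rule: finite_induct)
    (simp_all add: smooth_maps_const smooth_maps_bounded_bilinear[OF bounded_bilinear_mult])

lemma smooth_maps_inner_Basis:
  fixes f :: "'a \<Rightarrow> 'b::euclidean_space"
  assumes "\<And>b. b \<in> Basis \<Longrightarrow> (\<lambda>x. f x \<bullet> b) \<in> smooth_maps atlas"
  shows "f \<in> smooth_maps atlas"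
proof -
  have "(\<lambda>x. \<Sum>b\<in>Basis. (f x \<bullet> b) *\<^sub>R b) \<in> smooth_maps atlas"
    by (intro smooth_maps_sum smooth_maps_bounded_bilinear[OF bounded_bilinear_scaleR]
        smooth_maps_const assms) auto
  then show ?thesis by (simp add: euclidean_representation)
qed

lemma smooth_maps_inner:
  "f \<in> smooth_maps atlas \<Longrightarrow> (\<lambda>x. f x \<bullet> c) \<in> smooth_maps atlas"
  by (rule smooth_maps_bounded_linear[OF bounded_linear_inner_left])

lemma smooth_maps_nth:
  fixes f :: "'a \<Rightarrow> 'b::real_normed_vector^'n"
  shows "f \<in> smooth_maps atlas \<Longrightarrow> (\<lambda>x. f x $ i) \<in> smooth_maps atlas"
  by (rule smooth_maps_bounded_linear[OF bounded_linear_vec_nth])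

lemma smooth_maps_vec:
  fixes f :: "'a \<Rightarrow> 'b::euclidean_space^'n"
  assumes "\<And>i. (\<lambda>x. f x $ i) \<in> smooth_maps atlas"
  shows "f \<in> smooth_maps atlas"
proof (rule smooth_maps_inner_Basis)
  fix b :: "'b^'n" assume "b \<in> Basis"
  then obtain i u where "b = axis i u" by (auto simp: Basis_vec_def)
  then show "(\<lambda>x. f x \<bullet> b) \<in> smooth_maps atlas"
    using smooth_maps_inner[OF assms[of i], of u] by (simp add: inner_axis)
qed

lemma smooth_maps_det:
  fixes f :: "'a \<Rightarrow> complex^'n^'n"
  assumes "\<And>i j. (\<lambda>x. f x $ i $ j) \<in> smooth_maps atlas"
  shows "(\<lambda>x. det (f x)) \<in> smooth_maps atlas"
  unfolding det_def
  by (intro smooth_maps_sum smooth_maps_prod smooth_maps_bounded_bilinear[OF bounded_bilinear_mult]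
      smooth_maps_const assms) auto

end

section \<open>Adjugates and Cramer's rule\<close>

section \<open>Spectral projections of rank one\<close>

text \<open>Cofactors appear as determinants with a column replaced by a unit vector, without signs
  or minors: the action on a vector is then Cramer's rule, and the entries are visibly polynomial in
  those of \<open>A\<close>.\<close>

definition adjugate :: "'b::comm_ring_1^'n^'n \<Rightarrow> 'b^'n^'n" where
  "adjugate A = (\<chi> k j. det (\<chi> a b. if b = k then of_bool (a = j) else A $ a $ b))"

text \<open>The expansions over permutations agree term by term: if \<open>p j = k\<close>, both
  products have the factor 1 at \<open>j\<close> and agree elsewhere; otherwise each contains a zero
  factor.\<close>

lemma adjugate_row: "adjugate A $ k $ j = det (\<chi> a b. if a = j then of_bool (b = k) else A $ a $ b)"
proof -
  have "(\<Prod>i\<in>UNIV. if p i = k then of_bool (i = j) else A $ i $ p i) =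
      (\<Prod>i\<in>UNIV. if i = j then of_bool (p i = k) else A $ i $ p i)"
    if p: "p permutes UNIV" for p
  proof (cases "p j = k")
    case True
    then have "p i = k \<longleftrightarrow> i = j" for i
      using permutes_inj[OF p] by (auto dest: injD)
    then show ?thesis by (intro prod.cong) auto
  next
    case False
    moreover obtain i where "p i = k" using permutes_surj[OF p] by (metis surjD)
    ultimately have "\<exists>i. (if p i = k then of_bool (i = j) else A $ i $ p i) = 0"
      and "\<exists>i. (if i = j then of_bool (p i = k) else A $ i $ p i) = 0"
      by (metis of_bool_eq(1))+
    then show ?thesis by (subst (1 2) prod_zero) auto
  qed
  then show ?thesis unfolding adjugate_def det_def by (auto intro!: sum.cong)
qed

lemma adjugate_transpose: "adjugate (transpose A) = transpose (adjugate A)"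
proof -
  have "(\<chi> a b. if b = k then of_bool (a = j) else transpose A $ a $ b) =
      transpose (\<chi> a b. if a = k then of_bool (b = j) else A $ a $ b)" (is "?C j k = _") for j k
    by (simp add: transpose_def vec_eq_iff)
  then have "det (?C j k) = adjugate A $ j $ k" for j k
    by (simp only: det_transpose adjugate_row)
  then have "adjugate (transpose A) $ k $ j = adjugate A $ j $ k" for j k
    by (simp only: adjugate_def[of "transpose A"] vec_lambda_beta)
  then show ?thesis
    by (simp add: vec_eq_iff transpose_def)
qed

text \<open>The determinant is linear in the replaced column, and \<open>w\<close> is the
  combination of unit vectors with coefficients \<open>w $ j\<close>. Transposition turns that
  column into a row.\<close>

lemma adjugate_mult_vector:
  "(adjugate A *v w) $ k = det (\<chi> a b. if b = k then w $ a else A $ a $ b)"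
  for A :: "'b::field^'n^'n"
proof -
  let ?r = "\<lambda>j. \<chi> b a. if b = k then of_bool (a = j) else A $ a $ b"
  have tr: "(\<chi> a b. if b = k then f a else A $ a $ b) =
      transpose (\<chi> b. if b = k then (\<chi> a. f a) else (\<chi> a. A $ a $ b))" for f
    by (simp add: transpose_def vec_eq_iff)
  have w: "(\<chi> a. w $ a) = (\<Sum>j\<in>UNIV. w $ j *s (\<chi> a. of_bool (a = j)))"
    by (simp add: vec_eq_iff of_bool_def if_distrib[of "\<lambda>x. _ * x"] cong: if_cong)
  have "det (\<chi> a b. if b = k then w $ a else A $ a $ b) =
      (\<Sum>j\<in>UNIV. det (\<chi> b. if b = k then w $ j *s (\<chi> a. of_bool (a = j)) else (\<chi> a. A $ a $ b)))"
    unfolding tr det_transpose w by (rule det_linear_row_sum) simp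
  then show ?thesis
    unfolding det_row_mul matrix_vector_mult_def adjugate_def vec_lambda_beta tr det_transpose
    by (simp add: mult.commute)
qed

text \<open>For \<open>A *v w\<close> in place of \<open>w\<close>, Cramer's rule evaluates the
  determinant in \<open>adjugate_mult_vector\<close> as \<open>w $ k * det A\<close>.\<close>

lemma adjugate_mult: "adjugate A ** A = mat (det A)" for A :: "'b::field^'n^'n"
proof -
  have "(adjugate A *v (A *v w)) $ k = w $ k * det A" for w k
    by (simp add: adjugate_mult_vector cramer_lemma)
  then have "(adjugate A ** A) *v w = mat (det A) *v w" for w
    by (simp add: vec_eq_iff matrix_vector_mul_assoc[symmetric])
       (simp add: matrix_vector_mult_def mat_def if_distrib[of "\<lambda>x. x * _"] cong: if_cong)
  then show ?thesis by (metis matrix_eq)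
qed

lemma mult_adjugate: "A ** adjugate A = mat (det A)" for A :: "'b::field^'n^'n"
proof -
  have "transpose (A ** adjugate A) = mat (det A)"
    by (simp add: matrix_transpose_mul adjugate_mult flip: adjugate_transpose)
  then show ?thesis by (metis transpose_mat transpose_transpose)
qed

lemma det_nonzero_iff_ker: "det A \<noteq> 0 \<longleftrightarrow> (\<forall>z. A *v z = 0 \<longrightarrow> z = 0)" for A :: "'b::field^'n^'n"
  by (metis invertible_det_nz invertible_left_inverse matrix_left_invertible_ker)

lemma mat_mult_nth: "(mat s ** A) $ i $ j = s * A $ i $ j" for A :: "'b::semiring_1^'n^'m"
  by (simp add: matrix_matrix_mult_def mat_def if_distrib[of "\<lambda>x. x * _"] cong: if_cong)

section \<open>Linear algebra at a single point, with \<open>A\<close> standing for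
  \<open>H0 x - mat (\<mu> x)\<close>\<close>

locale rank_one_projection =
  fixes A p :: "complex^'n^'n"
  assumes compl: "complementary (null_space A) (range ((*v) A))"
    and dim: "vec.dim (null_space A) = 1"
    and proj: "projection_along p (null_space A) (range ((*v) A))"
begin

lemma decomposition:
  obtains u z where "w = u + A *v z" "A *v u = 0" "p *v u = u" "p *v (A *v z) = 0"
proof -
  obtain u z where "u \<in> null_space A" "w = u + A *v z"
    using compl unfolding complementary_def by blast
  then show thesis
    using that[of u z] proj by (simp add: projection_along_def null_space_def)
qed

lemma A_proj: "A ** p = 0" and proj_idem: "p ** p = p"
proof -
  have *: "p *v (p *v w) = p *v w \<and> A *v (p *v w) = 0" for w
    by (rule decomposition[of w]) (simp add: matrix_vector_right_distrib)
  show "A ** p = 0" "p ** p = p"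
    using * by (simp_all add: matrix_eq flip: matrix_vector_mul_assoc)
qed

text \<open>Since \<open>A ** p = 0\<close>, every column of \<open>p\<close> lies in the kernel,
  the line spanned by \<open>v\<close>; the coefficients of the columns form \<open>l\<close>. Its
  normalisation against \<open>v\<close> comes from \<open>p *v v = v\<close>.\<close>

lemma rank_one:
  obtains v l where "v \<noteq> 0" "A *v v = 0" "p = (\<chi> i j. v $ i * l $ j)"
    "(\<Sum>j\<in>UNIV. l $ j * v $ j) = 1" "\<And>u. A *v u = 0 \<Longrightarrow> \<exists>c. u = c *s v"
proof -
  obtain B where B: "B \<subseteq> null_space A" "vec.independent B" "null_space A \<subseteq> vec.span B" "card B = 1"
    using vec.basis_exists[of "null_space A"] dim by metis
  then obtain v where v: "B = {v}" by (metis card_1_singletonE)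
  have nz: "v \<noteq> 0" and Av: "A *v v = 0"
    using B by (auto simp: v null_space_def)
  have ex: "\<exists>c. u = c *s v" if "A *v u = 0" for u
    using that B(3) by (auto simp: v null_space_def vec.span_singleton)
  have "\<exists>c. p *v axis j 1 = c *s v" for j
    by (rule ex) (simp add: matrix_vector_mul_assoc A_proj)
  then obtain l where l: "p *v axis j 1 = l j *s v" for j by metis
  have p: "p $ i $ j = v $ i * l j" for i j
    using l[of j] by (simp add: vec_eq_iff matrix_vector_mult_def axis_def
        mult.commute[of "l _"] if_distrib[of "\<lambda>x. _ * x"] cong: if_cong)
  have "p *v v = v"
    using proj Av by (simp add: projection_along_def null_space_def)
  then have "v $ i * (\<Sum>j\<in>UNIV. l j * v $ j) = v $ i" for i
    by (simp add: vec_eq_iff matrix_vector_mult_def p sum_distrib_left mult.assoc)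
  then have "(\<Sum>j\<in>UNIV. l j * v $ j) = 1"
    using nz by (auto simp: vec_eq_iff)
  then show thesis
    using that[OF nz Av _ _ ex, of "\<chi> j. l j"] p by (simp add: vec_eq_iff)
qed

text \<open>For p = v l^T one has p C p = v (l^T C v) l^T, and the scalar in the middle is the trace
  of C p.\<close>

lemma proj_mult_proj: "p ** C ** p = mat (trace (C ** p)) ** p"
proof -
  obtain v l where p: "p = (\<chi> i j. v $ i * l $ j)" "(\<Sum>j\<in>UNIV. l $ j * v $ j) = 1"
    by (rule rank_one) blast
  let ?s = "\<Sum>a\<in>UNIV. \<Sum>b\<in>UNIV. l $ a * C $ a $ b * v $ b"
  have "trace (C ** p) = ?s"
    by (simp add: trace_def matrix_matrix_mult_def p sum_distrib_right sum_distrib_left mult_ac)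
  moreover have "(p ** C ** p) $ i $ j = v $ i * ?s * l $ j" for i j
    unfolding p(1) matrix_matrix_mult_def
    by (simp add: sum_distrib_left sum_distrib_right mult_ac) (rule sum.swap)
  ultimately show ?thesis by (simp add: vec_eq_iff mat_mult_nth p(1) mult_ac)
qed

lemma trace_proj: "trace p = 1"
proof -
  obtain v l where p: "p = (\<chi> i j. v $ i * l $ j)" "(\<Sum>j\<in>UNIV. l $ j * v $ j) = 1"
    by (rule rank_one) blast
  then show ?thesis by (simp add: trace_def mult.commute)
qed

text \<open>If \<open>v\<close> spans the kernel and \<open>v $ k \<noteq> 0\<close>, replacing
  column \<open>k\<close> of \<open>A\<close> by \<open>v\<close> gives an invertible matrix,
  because kernel and range meet only in 0. Its determinant is a coordinate of
  \<open>adjugate A *v v\<close>.\<close>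

lemma adjugate_nonzero: "adjugate A \<noteq> 0"
proof -
  obtain v l where v: "v \<noteq> 0" "A *v v = 0" and ex: "\<And>u. A *v u = 0 \<Longrightarrow> \<exists>c. u = c *s v"
    by (rule rank_one) blast
  obtain k where k: "v $ k \<noteq> 0" using v by (auto simp: vec_eq_iff)
  let ?B = "\<chi> a b. if b = k then v $ a else A $ a $ b"
  have "z = 0" if z: "?B *v z = 0" for z
  proof -
    \<comment> \<open>Column \<open>k\<close> of \<open>?B\<close> is \<open>v\<close>, so
      \<open>?B\<close> applies \<open>A\<close> to \<open>z\<close> with its k-th coordinate
      deleted and adds \<open>z $ k\<close> times \<open>v\<close>.\<close>
    have Bz: "?B *v z = A *v (z - z $ k *s axis k 1) + z $ k *s v"
      by (simp add: vec_eq_iff matrix_vector_mult_def axis_def sum.remove[of UNIV k] mult.commute)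
    have "z $ k *s v = A *v (z $ k *s axis k 1 - z)"
      using z Bz unfolding matrix_vector_mult_diff_distrib by (simp add: algebra_simps eq_diff_eq)
    moreover have "A *v (z $ k *s v) = 0"
      using v by (simp add: vector_scalar_commute)
    ultimately have "z $ k *s v \<in> null_space A \<inter> range ((*v) A)"
      by (auto simp: null_space_def)
    then have "z $ k *s v = 0"
      using compl unfolding complementary_def by blast
    then have zk: "z $ k = 0"
      using v by (simp add: vector_mul_eq_0)
    have "A *v z = 0"
      using z zk Bz by simp
    then obtain c where "z = c *s v" using ex by blast
    with zk k show "z = 0" by simp
  qed
  then have "det ?B \<noteq> 0"
    unfolding det_nonzero_iff_ker by blast
  then have "(adjugate A *v v) $ k \<noteq> 0"
    by (simp add: adjugate_mult_vector)
  then show ?thesis by auto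
qed

text \<open>As \<open>A\<close> is singular, its products with \<open>adjugate A\<close> in both
  orders vanish. So \<open>adjugate A\<close> is unchanged by multiplication with \<open>p\<close>
  on both sides, hence a multiple of \<open>p\<close>, and \<open>trace p = 1\<close> identifies the
  factor. This makes \<open>p\<close> a rational expression in the entries of
  \<open>A\<close>.\<close>

lemma proj_eq_adjugate: "trace (adjugate A) \<noteq> 0" "p $ i $ j = adjugate A $ i $ j / trace (adjugate A)"
proof -
  let ?M = "adjugate A"
  obtain v l where "v \<noteq> 0" "A *v v = 0" by (rule rank_one) blast
  then have "det A = 0"
    using det_nonzero_iff_ker by blast
  then have AM: "A ** ?M = 0" "?M ** A = 0"
    by (simp_all add: mult_adjugate adjugate_mult)
  have "?M *v w = (p ** ?M ** p) *v w" for w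
  proof -
    have "?M *v u \<in> null_space A" for u
      by (simp add: null_space_def matrix_vector_mul_assoc AM)
    then have pM: "p *v (?M *v u) = ?M *v u" for u
      using proj by (simp add: projection_along_def)
    obtain u z where "w = u + A *v z" "A *v u = 0" "p *v u = u" "p *v (A *v z) = 0"
      by (rule decomposition)
    moreover have "?M *v (A *v z) = 0"
      by (simp add: matrix_vector_mul_assoc AM)
    ultimately show ?thesis
      by (simp add: matrix_vector_right_distrib pM flip: matrix_vector_mul_assoc)
  qed
  then have "?M = mat (trace (?M ** p)) ** p"
    by (simp add: matrix_eq flip: proj_mult_proj)
  then obtain s where s: "?M $ i $ j = s * p $ i $ j" for i j
    by (metis mat_mult_nth)
  then have "trace ?M = s"
    using trace_proj by (simp add: trace_def flip: sum_distrib_left)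
  moreover have "s \<noteq> 0"
    using s adjugate_nonzero by (auto simp: vec_eq_iff)
  ultimately show "trace ?M \<noteq> 0" "p $ i $ j = ?M $ i $ j / trace ?M"
    by (simp_all add: s)
qed

end

section \<open>Coordinate expansions of linear and bilinear maps\<close>

section \<open>Differentials along vector fields\<close>

lemma bounded_bilinear_matrix_mult:
  "bounded_bilinear ((**) :: complex^'n^'m \<Rightarrow> complex^'k^'n \<Rightarrow> complex^'k^'m)"
  unfolding bilinear_conv_bounded_bilinear[symmetric] bilinear_def
  by (auto intro!: linearI simp: vec_eq_iff matrix_matrix_mult_def sum.distrib distrib_left
      distrib_right scaleR_sum_right)

lemma bounded_bilinear_matrix_vector_mult:
  "bounded_bilinear ((*v) :: complex^'n^'m \<Rightarrow> complex^'n \<Rightarrow> complex^'m)"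
  unfolding bilinear_conv_bounded_bilinear[symmetric] bilinear_def
  by (auto intro!: linearI simp: vec_eq_iff matrix_vector_mult_def sum.distrib distrib_left
      distrib_right scaleR_sum_right)

interpretation mm: bounded_bilinear "(**) :: complex^'n^'m \<Rightarrow> complex^'k^'n \<Rightarrow> complex^'k^'m"
  by (rule bounded_bilinear_matrix_mult)

interpretation mv: bounded_bilinear "(*v) :: complex^'n^'m \<Rightarrow> complex^'n \<Rightarrow> complex^'m"
  by (rule bounded_bilinear_matrix_vector_mult)

lemma bounded_linear_trace: "bounded_linear (trace :: complex^'n^'n \<Rightarrow> complex)"
  unfolding linear_conv_bounded_linear[symmetric]
  by (auto intro!: linearI simp: trace_def sum.distrib scaleR_sum_right)

text \<open>Vector fields act on real functions only. Expansion with the constant coefficients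
  \<open>L b \<bullet> c\<close> carries their linearity over to vector-valued
  differentials.\<close>

lemma bounded_linear_inner_expand:
  fixes L :: "'b::euclidean_space \<Rightarrow> 'c::euclidean_space"
  assumes "bounded_linear L"
  shows "L u \<bullet> c = (\<Sum>b\<in>Basis. (L b \<bullet> c) * (u \<bullet> b))"
proof -
  interpret bounded_linear L by fact
  have "L u = (\<Sum>b\<in>Basis. (u \<bullet> b) *\<^sub>R L b)"
    by (metis (no_types, lifting) euclidean_representation scaleR sum sum.cong)
  then show ?thesis by (simp add: inner_sum_left mult.commute)
qed

lemma bounded_bilinear_inner_expand:
  fixes m :: "'b::euclidean_space \<Rightarrow> 'c::euclidean_space \<Rightarrow> 'd::euclidean_space"
  assumes "bounded_bilinear m"
  shows "m u w \<bullet> c = (\<Sum>b\<in>Basis. \<Sum>d\<in>Basis. (m b d \<bullet> c) * ((u \<bullet> b) * (w \<bullet> d)))"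
proof -
  note m = bounded_bilinear.bounded_linear_left[OF assms] bounded_bilinear.bounded_linear_right[OF assms]
  have left: "m u w \<bullet> c = (\<Sum>b\<in>Basis. (m b w \<bullet> c) * (u \<bullet> b))"
    by (rule bounded_linear_inner_expand[OF m(1)])
  have right: "m b w \<bullet> c = (\<Sum>d\<in>Basis. (m b d \<bullet> c) * (w \<bullet> d))" for b
    by (rule bounded_linear_inner_expand[OF m(2)])
  show ?thesis
    unfolding left unfolding right by (simp add: sum_distrib_left mult_ac)
qed

lemma diff_inner_Basis: "b \<in> Basis \<Longrightarrow> diff f X x \<bullet> b = X (\<lambda>y. f y \<bullet> b) x"
  by (simp add: diff_def inner_sum_left_Basis)

lemma diff_vf_add: "diff f (vf_add X Y) x = diff f X x + diff f Y x"
  by (simp add: diff_def vf_add_def scaleR_left_distrib sum.distrib)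

lemma diff_vf_scale: "diff f (vf_scale g X) x = g x *\<^sub>R diff f X x"
  by (simp add: diff_def vf_scale_def scaleR_sum_right)

text \<open>This is d(df) = 0 evaluated on two fields; in the curvature it absorbs the second
  derivatives.\<close>

lemma diff_lie_bracket:
  "diff f (lie_bracket X Y) x = diff (diff f Y) X x - diff (diff f X) Y x"
  by (rule euclidean_eqI) (simp add: diff_inner_Basis inner_diff_left lie_bracket_def)

section \<open>Leibniz rules for vector-valued differentials\<close>

context smooth_manifold
begin

lemma vector_field_smooth: "X \<in> vector_fields atlas \<Longrightarrow> f \<in> smooth_maps atlas \<Longrightarrow> X f \<in> smooth_maps atlas"
  by (simp add: vector_fields_def)

lemma vector_field_add:
  "X \<in> vector_fields atlas \<Longrightarrow> f \<in> smooth_maps atlas \<Longrightarrow> g \<in> smooth_maps atlas \<Longrightarrow>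
    X (\<lambda>x. f x + g x) = (\<lambda>x. X f x + X g x)"
  by (simp add: vector_fields_def)

lemma vector_field_cmult:
  "X \<in> vector_fields atlas \<Longrightarrow> f \<in> smooth_maps atlas \<Longrightarrow> X (\<lambda>x. c * f x) = (\<lambda>x. c * X f x)"
  by (simp add: vector_fields_def)

lemma vector_field_mult:
  "X \<in> vector_fields atlas \<Longrightarrow> f \<in> smooth_maps atlas \<Longrightarrow> g \<in> smooth_maps atlas \<Longrightarrow>
    X (\<lambda>x. f x * g x) = (\<lambda>x. f x * X g x + X f x * g x)"
  by (simp add: vector_fields_def)

lemma vector_field_nonsmooth:
  "X \<in> vector_fields atlas \<Longrightarrow> f \<notin> smooth_maps atlas \<Longrightarrow> X f = (\<lambda>x. 0)"
  by (simp add: vector_fields_def)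

lemma vector_field_const:
  assumes "X \<in> vector_fields atlas"
  shows "X (\<lambda>x. c) = (\<lambda>x. 0)"
proof -
  \<comment> \<open>The Leibniz rule for 1 = 1 * 1 gives X 1 = 2 X 1.\<close>
  have "X (\<lambda>x. 1) = (\<lambda>x. 0)"
    using vector_field_mult[OF assms, of "\<lambda>x. 1" "\<lambda>x. 1"]
    by (simp add: fun_eq_iff smooth_maps_const)
  then show ?thesis
    using vector_field_cmult[OF assms, of "\<lambda>x. 1" c] by (simp add: smooth_maps_const)
qed

lemma vector_field_sum:
  assumes "X \<in> vector_fields atlas"
  shows "finite I \<Longrightarrow> (\<And>i. i \<in> I \<Longrightarrow> f i \<in> smooth_maps atlas) \<Longrightarrow>
    X (\<lambda>x. \<Sum>i\<in>I. f i x) = (\<lambda>x. \<Sum>i\<in>I. X (f i) x)"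
  by (induction I rule: finite_induct)
    (simp_all add: vector_field_const[OF assms] vector_field_add[OF assms] smooth_maps_sum)

lemma smooth_maps_mult:
  fixes f g :: "'a \<Rightarrow> real"
  shows "f \<in> smooth_maps atlas \<Longrightarrow> g \<in> smooth_maps atlas \<Longrightarrow> (\<lambda>x. f x * g x) \<in> smooth_maps atlas"
  by (rule smooth_maps_bounded_bilinear[OF bounded_bilinear_mult])

lemma lie_bracket_vector_field:
  assumes X: "X \<in> vector_fields atlas" and Y: "Y \<in> vector_fields atlas"
  shows "lie_bracket X Y \<in> vector_fields atlas"
proof -
  note XY = vector_field_smooth[OF X] vector_field_smooth[OF Y] smooth_maps_add smooth_maps_mult
    vector_field_add[OF X] vector_field_add[OF Y] vector_field_mult[OF X] vector_field_mult[OF Y]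
    vector_field_cmult[OF X] vector_field_cmult[OF Y]
  \<comment> \<open>On a non-smooth function each field returns its default value, the zero
    function, which the other field sends to zero again.\<close>
  have "lie_bracket X Y f = (\<lambda>x. 0)" if "f \<notin> smooth_maps atlas" for f
    using that by (simp add: lie_bracket_def vector_field_nonsmooth X Y vector_field_const)
  then show ?thesis
    by (simp add: vector_fields_def) (auto simp: lie_bracket_def XY smooth_maps_diff algebra_simps)
qed

lemma smooth_maps_diff_form:
  assumes "X \<in> vector_fields atlas" "f \<in> smooth_maps atlas"
  shows "diff f X \<in> smooth_maps atlas"
  by (rule smooth_maps_inner_Basis)
    (simp add: diff_inner_Basis vector_field_smooth assms smooth_maps_inner)

lemma diff_bounded_linear:
  fixes f :: "'a \<Rightarrow> 'b::euclidean_space" and L :: "'b \<Rightarrow> 'c::euclidean_space"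
  assumes X: "X \<in> vector_fields atlas" and L: "bounded_linear L" and f: "f \<in> smooth_maps atlas"
  shows "diff (\<lambda>y. L (f y)) X x = L (diff f X x)"
proof (rule euclidean_eqI)
  fix c :: 'c assume c: "c \<in> Basis"
  have "X (\<lambda>y. \<Sum>b\<in>Basis. (L b \<bullet> c) * (f y \<bullet> b)) x = (\<Sum>b\<in>Basis. (L b \<bullet> c) * X (\<lambda>y. f y \<bullet> b) x)"
    by (simp add: vector_field_sum[OF X] vector_field_cmult[OF X] smooth_maps_mult smooth_maps_const
        smooth_maps_inner[OF f])
  then show "diff (\<lambda>y. L (f y)) X x \<bullet> c = L (diff f X x) \<bullet> c"
    by (simp add: diff_inner_Basis c bounded_linear_inner_expand[OF L, of "f _" c]
        bounded_linear_inner_expand[OF L, of "diff f X x" c])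
qed

lemma diff_bounded_bilinear:
  fixes f :: "'a \<Rightarrow> 'b::euclidean_space" and g :: "'a \<Rightarrow> 'c::euclidean_space"
    and m :: "'b \<Rightarrow> 'c \<Rightarrow> 'd::euclidean_space"
  assumes X: "X \<in> vector_fields atlas" and m: "bounded_bilinear m"
    and f: "f \<in> smooth_maps atlas" and g: "g \<in> smooth_maps atlas"
  shows "diff (\<lambda>y. m (f y) (g y)) X x = m (f x) (diff g X x) + m (diff f X x) (g x)"
proof (rule euclidean_eqI)
  fix c :: 'd assume c: "c \<in> Basis"
  have "X (\<lambda>y. \<Sum>b\<in>Basis. \<Sum>d\<in>Basis. (m b d \<bullet> c) * ((f y \<bullet> b) * (g y \<bullet> d))) x =
      (\<Sum>b\<in>Basis. \<Sum>d\<in>Basis. (m b d \<bullet> c) *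
        ((f x \<bullet> b) * X (\<lambda>y. g y \<bullet> d) x + X (\<lambda>y. f y \<bullet> b) x * (g x \<bullet> d)))"
    by (simp add: vector_field_sum[OF X] vector_field_cmult[OF X] vector_field_mult[OF X]
        smooth_maps_sum smooth_maps_mult smooth_maps_const smooth_maps_inner[OF f] smooth_maps_inner[OF g])
  then show "diff (\<lambda>y. m (f y) (g y)) X x \<bullet> c = (m (f x) (diff g X x) + m (diff f X x) (g x)) \<bullet> c"
    by (simp add: diff_inner_Basis c bounded_bilinear_inner_expand[OF m, of "f _" "g _" c] inner_add_left
        bounded_bilinear_inner_expand[OF m, of "f x" "diff g X x" c]
        bounded_bilinear_inner_expand[OF m, of "diff f X x" "g x" c]
        distrib_left sum.distrib)
qed

lemma diff_add:
  assumes "X \<in> vector_fields atlas" "f \<in> smooth_maps atlas" "g \<in> smooth_maps atlas"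
  shows "diff (\<lambda>y. f y + g y) X x = diff f X x + diff g X x"
  by (rule euclidean_eqI)
    (simp add: diff_inner_Basis inner_add_left vector_field_add[OF assms(1)] smooth_maps_inner assms)

lemma diff_diff:
  assumes "X \<in> vector_fields atlas" "f \<in> smooth_maps atlas" "g \<in> smooth_maps atlas"
  shows "diff (\<lambda>y. f y - g y) X x = diff f X x - diff g X x"
  using diff_add[OF assms(1,2) smooth_maps_bounded_linear[OF bounded_linear_minus[OF bounded_linear_ident] assms(3)]]
    diff_bounded_linear[OF assms(1) bounded_linear_minus[OF bounded_linear_ident] assms(3)] by simp

lemma diff_const: "X \<in> vector_fields atlas \<Longrightarrow> diff (\<lambda>y. c) X x = 0"
  by (simp add: diff_def vector_field_const)

lemma wedge_diff_two_forms:
  fixes f :: "'a \<Rightarrow> 'b::euclidean_space" and g :: "'a \<Rightarrow> 'c::euclidean_space"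
    and m :: "'b \<Rightarrow> 'c \<Rightarrow> 'd::euclidean_space"
  assumes m: "bounded_bilinear m" and f: "f \<in> smooth_maps atlas" and g: "g \<in> smooth_maps atlas"
  shows "wedge m (diff f) (diff g) \<in> two_forms atlas"
proof -
  interpret m: bounded_bilinear m by fact
  have "wedge m (diff f) (diff g) X Y \<in> smooth_maps atlas"
    if "X \<in> vector_fields atlas" "Y \<in> vector_fields atlas" for X Y
    unfolding wedge_def
    by (intro smooth_maps_diff smooth_maps_bounded_bilinear[OF m] smooth_maps_diff_form that f g)
  then show ?thesis
    by (auto simp: two_forms_def wedge_def diff_vf_add diff_vf_scale m.add_left m.add_right
        m.scaleR_left m.scaleR_right algebra_simps)
qed


section \<open>From the connection form to the curvature\<close>

section \<open>The adapted connection\<close>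

text \<open>The Leibniz rule for p p = p. It makes the derivative of \<open>p\<close> off-diagonal:
  it maps the image of \<open>p\<close> into the kernel and the kernel into the image.\<close>

lemma diff_idempotent:
  fixes p :: "'a \<Rightarrow> complex^'n^'n"
  assumes "X \<in> vector_fields atlas" "p \<in> smooth_maps atlas" "\<And>x. p x ** p x = p x"
  shows "p x ** diff p X x + diff p X x ** p x = diff p X x"
  using diff_bounded_bilinear[OF assms(1) bounded_bilinear_matrix_mult assms(2,2), of x]
  unfolding assms(3) by (rule sym)

lemma adapted_connection_eq:
  fixes p :: "'a \<Rightarrow> complex^'n^'n"
  assumes X: "X \<in> vector_fields atlas" and p: "p \<in> smooth_maps atlas" "\<And>x. p x ** p x = p x"
    and \<xi>: "\<xi> \<in> smooth_maps atlas"
  shows "adapted_connection p \<xi> X x =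
    diff \<xi> X x + (p x ** diff p X x - diff p X x ** p x) *v \<xi> x"
proof -
  have q: "(\<lambda>y. mat 1 - p y) \<in> smooth_maps atlas"
    by (intro smooth_maps_diff smooth_maps_const p)
  have dq: "diff (\<lambda>y. mat 1 - p y) X x = - diff p X x"
    by (simp add: diff_diff[OF X smooth_maps_const p(1)] diff_const[OF X])
  note leibniz = diff_bounded_bilinear[OF X bounded_bilinear_matrix_vector_mult _ \<xi>]
  have "adapted_connection p \<xi> X x =
      p x *v (p x *v diff \<xi> X x + diff p X x *v \<xi> x)
      + (mat 1 - p x) *v ((mat 1 - p x) *v diff \<xi> X x - diff p X x *v \<xi> x)"
    by (simp add: adapted_connection_def leibniz[OF p(1)] leibniz[OF q] dq mv.minus_left)
  \<comment> \<open>Both p and I - p are idempotent and they sum to I, so their two contributions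
    restore the full derivative of \<xi>.\<close>
  also have "\<dots> = diff \<xi> X x + ((p x ** diff p X x) *v \<xi> x - (diff p X x - p x ** diff p X x) *v \<xi> x)"
    by (simp add: mv.diff_left mv.add_right mv.diff_right matrix_vector_mul_assoc mm.diff_left p)
  also have "diff p X x - p x ** diff p X x = diff p X x ** p x"
    using diff_idempotent[OF X p, of x] by (simp add: algebra_simps)
  finally show ?thesis by (simp add: mv.diff_left)
qed

text \<open>Multiplying the hypotheses by \<open>p\<close> on both sides gives p x p = p y p = 0.
  Two of the four products then vanish, and the other two combine to -x (p y + y p).\<close>

lemma commutator_idempotent_derivatives:
  fixes p x y :: "complex^'n^'n"
  assumes p: "p ** p = p" and x: "p ** x + x ** p = x" and y: "p ** y + y ** p = y"
  shows "(p ** x - x ** p) ** (p ** y - y ** p) = - (x ** y)"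
proof -
  have "p ** x ** p + p ** x ** p = p ** x ** p"
    using arg_cong[OF x, of "\<lambda>z. p ** z ** p"]
    by (simp add: mm.add_left mm.add_right matrix_mul_assoc p) (simp add: p flip: matrix_mul_assoc)
  then have pxp: "p ** x ** p = 0" by simp
  have "p ** y ** p + p ** y ** p = p ** y ** p"
    using arg_cong[OF y, of "\<lambda>z. p ** z ** p"]
    by (simp add: mm.add_left mm.add_right matrix_mul_assoc p) (simp add: p flip: matrix_mul_assoc)
  then have pyp: "p ** y ** p = 0" by simp
  have xpyp: "x ** p ** y ** p = 0"
    using arg_cong[OF pyp, of "\<lambda>z. x ** z"] by (simp add: matrix_mul_assoc)
  have "(p ** x - x ** p) ** p = - (x ** p)"
    by (simp add: mm.diff_left pxp) (simp add: p flip: matrix_mul_assoc)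
  then have "(p ** x - x ** p) ** (p ** y) = - (x ** p ** y)"
    by (simp add: matrix_mul_assoc mm.minus_left)
  \<comment> \<open>After this rewriting the subtracted part vanishes by \<open>xpyp\<close>,
    leaving x y p.\<close>
  moreover have "p ** x ** y ** p = (x - x ** p) ** y ** p"
    using x by (metis add_diff_cancel_right')
  ultimately have "(p ** x - x ** p) ** (p ** y - y ** p) = - (x ** (p ** y + y ** p))"
    by (simp add: mm.diff_left mm.diff_right mm.add_right matrix_mul_assoc xpyp)
  then show ?thesis by (simp add: y)
qed

lemma adapted_connection_curvature:
  fixes p :: "'a \<Rightarrow> complex^'n^'n"
  assumes p: "p \<in> smooth_maps atlas" "\<And>x. p x ** p x = p x"
  shows "is_curvature atlas (adapted_connection p) (wedge (**) (diff p) (diff p))"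
proof -
  have "covariant_ext_deriv (adapted_connection p) (adapted_connection p \<xi>) X Y x
      = wedge (**) (diff p) (diff p) X Y x *v \<xi> x"
    if \<xi>: "\<xi> \<in> smooth_maps atlas" and X: "X \<in> vector_fields atlas" and Y: "Y \<in> vector_fields atlas"
    for \<xi> :: "'a \<Rightarrow> complex^'n" and X Y x
  proof -
    \<comment> \<open>The connection form: on sections the adapted connection is d + a.\<close>
    define a where "a Z y = p y ** diff p Z y - diff p Z y ** p y" for Z y
    have smooth_a: "a Z \<in> smooth_maps atlas" if "Z \<in> vector_fields atlas" for Z
      unfolding a_def
      by (intro smooth_maps_diff smooth_maps_bounded_bilinear[OF bounded_bilinear_matrix_mult]
          smooth_maps_diff_form that p)
    have D: "adapted_connection p \<eta> Z = (\<lambda>x. diff \<eta> Z x + a Z x *v \<eta> x)"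
      if "Z \<in> vector_fields atlas" "\<eta> \<in> smooth_maps atlas" for Z \<eta>
      unfolding a_def by (rule ext) (rule adapted_connection_eq[OF that(1) p that(2)])
    \<comment> \<open>The two terms with a single derivative of \<open>\<xi>\<close> are exchanged
      by swapping \<open>Z\<close> and \<open>W\<close>, so they cancel in the curvature.\<close>
    have DD: "adapted_connection p (adapted_connection p \<xi> W) Z x =
        diff (diff \<xi> W) Z x + a W x *v diff \<xi> Z x + diff (a W) Z x *v \<xi> x
        + a Z x *v diff \<xi> W x + (a Z x ** a W x) *v \<xi> x"
      if Z: "Z \<in> vector_fields atlas" and W: "W \<in> vector_fields atlas" for Z W
    proof -
      have aw: "(\<lambda>x. a W x *v \<xi> x) \<in> smooth_maps atlas"
        by (rule smooth_maps_bounded_bilinear[OF bounded_bilinear_matrix_vector_mult smooth_a[OF W] \<xi>])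
      note dw = smooth_maps_diff_form[OF W \<xi>]
      show ?thesis
        unfolding D[OF W \<xi>] D[OF Z smooth_maps_add[OF dw aw]] diff_add[OF Z dw aw]
          diff_bounded_bilinear[OF Z bounded_bilinear_matrix_vector_mult smooth_a[OF W] \<xi>]
        by (simp add: mv.add_right matrix_vector_mul_assoc)
    qed
    have da: "diff (a W) Z x = p x ** diff (diff p W) Z x + diff p Z x ** diff p W x
        - (diff p W x ** diff p Z x + diff (diff p W) Z x ** p x)"
      if Z: "Z \<in> vector_fields atlas" and W: "W \<in> vector_fields atlas" for Z W
    proof -
      note dw = smooth_maps_diff_form[OF W p(1)] and mm = bounded_bilinear_matrix_mult
      note pd = smooth_maps_bounded_bilinear[OF mm p(1) dw] smooth_maps_bounded_bilinear[OF mm dw p(1)]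
      have "a W = (\<lambda>y. p y ** diff p W y - diff p W y ** p y)"
        by (simp add: a_def fun_eq_iff)
      then show ?thesis
        by (simp only: diff_diff[OF Z pd] diff_bounded_bilinear[OF Z mm p(1) dw]
            diff_bounded_bilinear[OF Z mm dw p(1)])
    qed
    have aa: "a Z x ** a W x = - (diff p Z x ** diff p W x)"
      if Z: "Z \<in> vector_fields atlas" and W: "W \<in> vector_fields atlas" for Z W
      unfolding a_def
      by (rule commutator_idempotent_derivatives) (simp_all only: p diff_idempotent[OF Z p] diff_idempotent[OF W p])
    \<comment> \<open>The curvature of d + a is da plus the wedge of a with itself. Second
      derivatives of \<open>p\<close> cancel against \<open>a (lie_bracket X Y)\<close>; da leaves
      twice the commutator of the derivatives of \<open>p\<close>, and \<open>aa\<close> takes one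
      of the two away.\<close>
    have "diff (a Y) X x - diff (a X) Y x - a (lie_bracket X Y) x + a X x ** a Y x - a Y x ** a X x
        = wedge (**) (diff p) (diff p) X Y x"
      unfolding da[OF X Y] da[OF Y X] aa[OF X Y] aa[OF Y X]
      unfolding a_def wedge_def diff_lie_bracket[of p]
      by (simp add: mm.diff_left mm.diff_right algebra_simps)
    then show ?thesis
      unfolding covariant_ext_deriv_def DD[OF X Y] DD[OF Y X] D[OF lie_bracket_vector_field[OF X Y] \<xi>]
        diff_lie_bracket[of \<xi>]
      by (simp add: mv.add_left mv.diff_left flip: \<open>_ = wedge (**) (diff p) (diff p) X Y x\<close>)
  qed
  then show ?thesis
    unfolding is_curvature_def
    using wedge_diff_two_forms[OF bounded_bilinear_matrix_mult p(1) p(1)] by blast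
qed

lemma is_curvature_unique:
  fixes F G :: "('a, complex^'n^'n) form2"
  assumes "is_curvature atlas D F" "is_curvature atlas D G"
    and "X \<in> vector_fields atlas" "Y \<in> vector_fields atlas"
  shows "F X Y = G X Y"
proof
  fix x
  \<comment> \<open>Testing on the constant section with value \<open>w\<close> suffices, since
    these reach every vector at \<open>x\<close>.\<close>
  have "F X Y x *v w = G X Y x *v w" for w
    using assms smooth_maps_const[of w] unfolding is_curvature_def by metis
  then show "F X Y x = G X Y x" by (simp add: matrix_eq)
qed

section \<open>Smoothness of the eigenprojection\<close>

lemma smooth_maps_mat: "\<mu> \<in> smooth_maps atlas \<Longrightarrow> (\<lambda>x. mat (\<mu> x) :: complex^'n^'n) \<in> smooth_maps atlas"
  by (intro smooth_maps_vec, rename_tac i j, case_tac "i = j") (simp_all add: mat_def smooth_maps_const)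

text \<open>The projection is specified only point by point; the adjugate formula presents its
  entries as quotients of smooth functions with nonvanishing denominator.\<close>

lemma smooth_maps_projection:
  fixes A p :: "'a \<Rightarrow> complex^'n^'n"
  assumes A: "A \<in> smooth_maps atlas" and p: "\<And>x. rank_one_projection (A x) (p x)"
  shows "p \<in> smooth_maps atlas"
proof -
  have "(\<lambda>x. (\<chi> a b. if b = k then of_bool (a = j) else A x $ a $ b) $ a $ b) \<in> smooth_maps atlas"
    for j k a b
    using smooth_maps_nth[OF smooth_maps_nth[OF A]] by (cases "b = k") (simp_all add: smooth_maps_const)
  then have adj: "(\<lambda>x. adjugate (A x) $ k $ j) \<in> smooth_maps atlas" for k j
    unfolding adjugate_def by (simp add: smooth_maps_det)
  have "(\<lambda>x. inverse (trace (adjugate (A x)))) \<in> smooth_maps atlas"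
    using rank_one_projection.proj_eq_adjugate(1)[OF p]
    by (intro smooth_maps_inverse) (auto simp: trace_def intro!: smooth_maps_sum adj)
  then have "(\<lambda>x. adjugate (A x) $ i $ j * inverse (trace (adjugate (A x)))) \<in> smooth_maps atlas" for i j
    by (intro smooth_maps_bounded_bilinear[OF bounded_bilinear_mult] adj)
  then show ?thesis
    using rank_one_projection.proj_eq_adjugate(2)[OF p]
    by (intro smooth_maps_vec) (simp add: divide_inverse)
qed

end


section \<open>Brackets and contractions as finite sums over pairs of vector fields\<close>

section \<open>The Poisson contraction\<close>

lemma sum_list_nth: "(\<Sum>z\<leftarrow>l. f z) $ i = (\<Sum>z\<leftarrow>l. f z $ i)" for f :: "'b \<Rightarrow> 'c::comm_monoid_add^'n"
  by (induction l) simp_all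

lemma sum_sum_list_swap: "(\<Sum>k\<in>K. \<Sum>z\<leftarrow>l. f k z) = (\<Sum>z\<leftarrow>l. \<Sum>k\<in>K. f k z)"
  for f :: "'b \<Rightarrow> 'c \<Rightarrow> 'd::comm_monoid_add"
  by (induction l) (simp_all add: sum.distrib)

lemma sum_list_linear: "linear L \<Longrightarrow> L (\<Sum>z\<leftarrow>l. f z) = (\<Sum>z\<leftarrow>l. L (f z))"
  by (induction l) (simp_all add: linear_0 linear_add)

lemma linear_mat: "linear (mat :: complex \<Rightarrow> complex^'n^'n)"
  by (rule linearI) (simp_all add: mat_def vec_eq_iff)

lemma trace_mat_mult: "trace (mat c ** B) = c * trace B" for B :: "complex^'n^'n"
  by (simp add: trace_def mat_mult_nth sum_distrib_left)

text \<open>In the application \<open>x, y, u, w\<close> are the derivatives of the projection and of \<open>A = H - \<mu>\<close> along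
  two vector fields; the last two hypotheses are the derivatives of \<open>A ** p = 0\<close>.\<close>

lemma (in rank_one_projection) proj_commutator_proj:
  fixes x y u w :: "complex^'n^'n"
  assumes x: "p ** x + x ** p = x" and y: "p ** y + y ** p = y"
    and u: "A ** x + u ** p = 0" and w: "A ** y + w ** p = 0"
  shows "p ** (x ** w - y ** u) ** p = mat (trace ((A + mat c) ** (x ** y - y ** x))) ** p"
proof -
  \<comment> \<open>Multiplied by \<open>A\<close> from the left, the hypothesis loses its first
    summand because \<open>A ** p = 0\<close>.\<close>
  have A_deriv: "A ** z = A ** z ** p" if "p ** z + z ** p = z" for z :: "complex^'n^'n"
    using arg_cong[OF that, of "\<lambda>z. A ** z"] by (simp add: mm.add_right matrix_mul_assoc A_proj)
  \<comment> \<open>Here \<open>A ** t\<close> absorbs a factor \<open>p\<close> on the right, so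
    the rank-one formula applies although only the left \<open>p\<close> is written.\<close>
  have sandwich: "p ** (z ** (A ** t)) = mat (trace (z ** (A ** t))) ** p"
    if "p ** t + t ** p = t" for z t :: "complex^'n^'n"
  proof -
    have "z ** (A ** t) ** p = z ** (A ** t)"
      by (metis A_deriv[OF that] matrix_mul_assoc)
    then show ?thesis
      using proj_mult_proj[of "z ** (A ** t)"] by (simp flip: matrix_mul_assoc)
  qed
  have "w ** p = - (A ** y)" "u ** p = - (A ** x)"
    using u w by (simp_all add: eq_neg_iff_add_eq_0 add.commute)
  then have "p ** (x ** w - y ** u) ** p = p ** (y ** (A ** x)) - p ** (x ** (A ** y))"
    by (simp add: mm.diff_left mm.diff_right mm.minus_right flip: matrix_mul_assoc)
  also have "\<dots> = mat (trace (y ** (A ** x)) - trace (x ** (A ** y))) ** p"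
    by (simp add: sandwich x y linear_diff[OF linear_mat] mm.diff_left)
  also have "trace (y ** (A ** x)) = trace (A ** (x ** y))"
    by (metis trace_mul_sym matrix_mul_assoc)
  also have "trace (x ** (A ** y)) = trace (A ** (y ** x))"
    by (metis trace_mul_sym matrix_mul_assoc)
  \<comment> \<open>The scalar matrix \<open>mat c\<close> contributes \<open>c\<close> times the
    trace of a commutator, which is zero.\<close>
  also have "trace (A ** (x ** y)) - trace (A ** (y ** x)) = trace ((A + mat c) ** (x ** y - y ** x))"
    by (simp add: mm.add_left mm.diff_right trace_add trace_sub trace_mat_mult trace_mul_sym[of y x])
  finally show ?thesis .
qed

context smooth_manifold
begin

text \<open>Taking entries commutes with \<open>diff\<close>, and an entry of a wedge of
  matrix-valued forms is a sum over \<open>k\<close> of scalar wedges, the same pattern as in the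
  matrix bracket.\<close>

lemma matrix_pbracket_eq_sum_wedge:
  fixes a b :: "'a \<Rightarrow> complex^'n^'n"
  assumes l: "set l \<subseteq> vector_fields atlas \<times> vector_fields atlas"
    and PiT: "\<And>\<omega>. \<omega> \<in> two_forms atlas \<Longrightarrow> PiT \<omega> = (\<lambda>x. \<Sum>(X, Y)\<leftarrow>l. \<omega> X Y x)"
    and a: "a \<in> smooth_maps atlas" and b: "b \<in> smooth_maps atlas"
  shows "matrix_pbracket PiT a b x = (\<Sum>(X, Y)\<leftarrow>l. wedge (**) (diff a) (diff b) X Y x)"
proof -
  have entry: "diff (\<lambda>y. f y $ i $ j) X x = diff f X x $ i $ j"
    if "f \<in> smooth_maps atlas" "X \<in> vector_fields atlas" for f :: "'a \<Rightarrow> complex^'n^'n" and X i j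
    using diff_bounded_linear[OF that(2) bounded_linear_compose[OF bounded_linear_vec_nth bounded_linear_vec_nth] that(1)] .
  have "(\<Sum>k\<in>UNIV. pbracket PiT (\<lambda>y. a y $ i $ k) (\<lambda>y. b y $ k $ j) x)
      = (\<Sum>(X, Y)\<leftarrow>l. wedge (**) (diff a) (diff b) X Y x) $ i $ j" for i j
  proof -
    have "pbracket PiT (\<lambda>y. a y $ i $ k) (\<lambda>y. b y $ k $ j) x =
        (\<Sum>(X, Y)\<leftarrow>l. wedge (*) (diff (\<lambda>y. a y $ i $ k)) (diff (\<lambda>y. b y $ k $ j)) X Y x)" for k
      unfolding pbracket_def
      by (subst PiT) (auto intro!: wedge_diff_two_forms bounded_bilinear_mult smooth_maps_nth a b)
    then have "(\<Sum>k\<in>UNIV. pbracket PiT (\<lambda>y. a y $ i $ k) (\<lambda>y. b y $ k $ j) x) =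
        (\<Sum>(X, Y)\<leftarrow>l. \<Sum>k\<in>UNIV. wedge (*) (diff (\<lambda>y. a y $ i $ k)) (diff (\<lambda>y. b y $ k $ j)) X Y x)"
      by (simp add: sum_sum_list_swap case_prod_unfold)
    also have "\<dots> = (\<Sum>(X, Y)\<leftarrow>l. wedge (**) (diff a) (diff b) X Y x $ i $ j)"
      using l by (intro arg_cong[where f = sum_list] map_cong)
        (auto simp: wedge_def entry a b matrix_matrix_mult_def sum_subtractf)
    finally show ?thesis by (simp add: sum_list_nth case_prod_unfold)
  qed
  then show ?thesis by (simp add: matrix_pbracket_def vec_eq_iff)
qed

text \<open>The sum formula for \<open>PiT\<close> is guaranteed only on \<open>two_forms\<close>;
  membership is what allows \<open>Lambda_C\<close> to be evaluated by it.\<close>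

lemma trace_two_form:
  fixes H :: "'a \<Rightarrow> complex^'n^'n"
  assumes H: "H \<in> smooth_maps atlas" and F: "F \<in> two_forms atlas"
  shows "(\<lambda>X Y x. trace (H x ** F X Y x)) \<in> two_forms atlas"
proof -
  have "(\<lambda>x. trace (H x ** F X Y x)) \<in> smooth_maps atlas"
    if "X \<in> vector_fields atlas" "Y \<in> vector_fields atlas" for X Y
    using F that by (intro smooth_maps_bounded_linear[OF bounded_linear_trace]
        smooth_maps_bounded_bilinear[OF bounded_bilinear_matrix_mult] H) (auto simp: two_forms_def)
  moreover have "trace (r *\<^sub>R B) = r *\<^sub>R trace B" for r and B :: "complex^'n^'n"
    by (rule linear_simps(5)[OF bounded_linear_trace])
  moreover have "trace (0 :: complex^'n^'n) = 0"
    by (simp add: trace_def)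
  ultimately show ?thesis
    using F by (simp add: two_forms_def mm.add_right mm.scaleR_right trace_add)
qed

end

text \<open>\<open>is_curvature\<close> determines a form only on vector fields, so the claims about
  the curvature range over every \<open>F\<close> with this property.\<close>

theorem mainTheorem3:
  fixes atlas :: "('a::{t2_space, second_countable_topology}, 'e::real_normed_vector) chart set"
    and PiT :: "'a bivector"
    and H0 \<pi>0 :: "'a \<Rightarrow> complex^'n^'n"
    and \<mu> :: "'a \<Rightarrow> complex"
  assumes "poisson_manifold atlas PiT"
    and "H0 \<in> smooth_maps atlas"
    and "regular_eigenvalue_function atlas H0 \<mu>"
    and "\<And>x. eigen_multiplicity (H0 x) (\<mu> x) = 1"
    and "\<And>x. projection_along (\<pi>0 x)
           (null_space (H0 x - mat (\<mu> x))) (range ((*v) (H0 x - mat (\<mu> x))))"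
  shows "is_curvature atlas (adapted_connection \<pi>0) (wedge (**) (diff \<pi>0) (diff \<pi>0)) \<and>
    (\<forall>F. is_curvature atlas (adapted_connection \<pi>0) F \<longrightarrow>
      (\<forall>X\<in>vector_fields atlas. \<forall>Y\<in>vector_fields atlas.
         F X Y = wedge (**) (diff \<pi>0) (diff \<pi>0) X Y) \<and>
      (\<forall>x. \<pi>0 x ** matrix_pbracket PiT \<pi>0 (\<lambda>y. H0 y - mat (\<mu> y)) x ** \<pi>0 x =
           mat (Lambda_C PiT H0 F x) ** \<pi>0 x))"
proof -
  interpret poisson_manifold atlas PiT by fact
  define A where "A y = H0 y - mat (\<mu> y)" for y
  interpret r: rank_one_projection "A x" "\<pi>0 x" for x
    using assms(3-5)
    by unfold_locales (auto simp: A_def regular_eigenvalue_function_def eigen_multiplicity_def)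
  have A: "A \<in> smooth_maps atlas"
    unfolding A_def using assms(2,3)
    by (intro smooth_maps_diff smooth_maps_mat) (simp_all add: regular_eigenvalue_function_def)
  have p: "\<pi>0 \<in> smooth_maps atlas"
    by (rule smooth_maps_projection[OF A r.rank_one_projection_axioms])
  note curv = adapted_connection_curvature[OF p r.proj_idem]
  obtain l where l: "set l \<subseteq> vector_fields atlas \<times> vector_fields atlas"
    and PiT: "\<And>\<omega>. \<omega> \<in> two_forms atlas \<Longrightarrow> PiT \<omega> = (\<lambda>x. \<Sum>(X, Y)\<leftarrow>l. \<omega> X Y x)"
    using bivector unfolding bivector_field_def by blast
  have "\<pi>0 x ** matrix_pbracket PiT \<pi>0 (\<lambda>y. H0 y - mat (\<mu> y)) x ** \<pi>0 x =
      mat (Lambda_C PiT H0 F x) ** \<pi>0 x"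
    if F: "is_curvature atlas (adapted_connection \<pi>0) F" for F x
  proof -
    \<comment> \<open>The identity is proved for each pair of vector fields before summing over the
      decomposition \<open>l\<close> of the bivector field.\<close>
    have step: "\<pi>0 x ** wedge (**) (diff \<pi>0) (diff A) X Y x ** \<pi>0 x
        = mat (trace (H0 x ** F X Y x)) ** \<pi>0 x"
      if X: "X \<in> vector_fields atlas" and Y: "Y \<in> vector_fields atlas" for X Y
    proof -
      have Ap: "A x ** diff \<pi>0 Z x + diff A Z x ** \<pi>0 x = 0" if Z: "Z \<in> vector_fields atlas" for Z
        using diff_bounded_bilinear[OF Z bounded_bilinear_matrix_mult A p, of x]
        by (simp add: r.A_proj diff_const[OF Z])
      \<comment> \<open>This supplies the scalar of \<open>proj_commutator_proj\<close>, with
        \<open>c = \<mu> x\<close>.\<close>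
      have "H0 x = A x + mat (\<mu> x)" by (simp add: A_def)
      moreover have "F X Y x = diff \<pi>0 X x ** diff \<pi>0 Y x - diff \<pi>0 Y x ** diff \<pi>0 X x"
        by (simp add: is_curvature_unique[OF F curv X Y] wedge_def)
      ultimately show ?thesis
        using r.proj_commutator_proj[OF diff_idempotent[OF X p r.proj_idem]
            diff_idempotent[OF Y p r.proj_idem] Ap[OF X] Ap[OF Y]]
        by (simp add: wedge_def)
    qed
    have Lambda: "Lambda_C PiT H0 F x = (\<Sum>(X, Y)\<leftarrow>l. trace (H0 x ** F X Y x))"
      unfolding Lambda_C_def
      using F by (subst PiT) (auto simp: is_curvature_def intro: trace_two_form[OF assms(2)])
    \<comment> \<open>Both sides of \<open>step\<close> depend linearly on the contracted values, so
      they pass through the sum over \<open>l\<close>.\<close>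
    have lin: "linear (\<lambda>B. \<pi>0 x ** B ** \<pi>0 x)" "linear (\<lambda>c. mat c ** \<pi>0 x)"
      by (rule linearI; simp add: mm.add_left mm.add_right mm.scaleR_left mm.scaleR_right
          linear_add[OF linear_mat] linear_scale[OF linear_mat])+
    have bracket: "matrix_pbracket PiT \<pi>0 A x = (\<Sum>(X, Y)\<leftarrow>l. wedge (**) (diff \<pi>0) (diff A) X Y x)"
      by (rule matrix_pbracket_eq_sum_wedge[OF l _ p A]) (rule PiT)
    have "\<pi>0 x ** matrix_pbracket PiT \<pi>0 A x ** \<pi>0 x =
        (\<Sum>(X, Y)\<leftarrow>l. \<pi>0 x ** wedge (**) (diff \<pi>0) (diff A) X Y x ** \<pi>0 x)"
      unfolding bracket
      by (simp add: sum_list_linear[OF lin(1)] case_prod_unfold)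
    also have "\<dots> = (\<Sum>(X, Y)\<leftarrow>l. mat (trace (H0 x ** F X Y x)) ** \<pi>0 x)"
      using l by (intro arg_cong[where f = sum_list] map_cong) (auto simp: step)
    also have "\<dots> = mat (Lambda_C PiT H0 F x) ** \<pi>0 x"
      unfolding Lambda by (simp add: sum_list_linear[OF lin(2)] case_prod_unfold)
    finally show ?thesis unfolding A_def .
  qed
  with curv is_curvature_unique[OF _ curv] show ?thesis by blast
qed

end
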